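(* Consider a sequence of multiple testing problems indexed by the number of hypotheses $m$, with sample size $n=n_m$ (which may be constant or depend on $m$), data-generating distribution $P_m$, set of true null hypotheses $I(P_m)$, set of true alternatives $I'(P_m)$, and $p$-values $p_1(W),\dots,p_m(W)$ with values in $S_n\subseteq[0,1]$, as described in the context. Assume the following. (A1) For every $m$ there is a partition $A_1,\dots,A_{B_m}$ of $\{1,\dots,m\}$, with $A_b\cap I(P_m)\neq\varnothing$ for all $b$, such that for every pair of permutations $g,g'\in\mathcal G$ the random variables $\min_{\tilde g\in\{g,g'\}}\min_{j\in A_b\cap I(P_m)}p_j(\tilde gW)$, $b=1,\dots,B_m$, are mutually independent under $P_m$. (A2) $|I'(P_m)|/B_m\to0$ as $m\to\infty$. (A3) $m_{B_m}:=\max_{b=1,\dots,B_m}|A_b|$ satisfies $m_{B_m}=o(\sqrt{B_m})$ as $m\to\infty$. (B1) If $G$ is a random permutation drawn uniformly from $\mathcal G$ (independently of $W$), then under $P_m$ the joint distribution of $\{p_j(W):j\in I(P_m)\}$ is identical to the joint distribution of $\{p_j(GW):j\in I(P_m)\}$. (B2) For every level $\alpha'\in(0,1)$ there is a constant $r<\infty$, not depending on $m$, $n$, $j$ or $W$, such that for $s=c_{m,n}(\alpha')\in S_n$ and all $W$, $$r^{-1}s\le P^*(p_j(W)\le s)\le r s\qquad\text{for all } j=1,\dots,m.$$ (B3) For all $j\in I(P_m)$ and $s\in S_n$, $P_m(p_j(W)\le s)=s$. Then for any $\alpha\in(0,1)$ and any $\delta\in(0,\alpha)$, $$P_m\{\hat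 c_{m,n}(\alpha)\ge c_{m,n}(\alpha-\delta)\}\to1\qquad\text{as } m\to\infty.$$
   Context: Setting. $W$ is a random data matrix, based on $n$ independent observations of an $m$-dimensional random vector with distribution $P_m$ and possibly additional deterministic response variables. There are $m$ null hypotheses $H_1,\dots,H_m$; $I(P_m)\subseteq\{1,\dots,m\}$ is the index set of those that are true under $P_m$, and $I'(P_m)=\{1,\dots,m\}\setminus I(P_m)$. The same test is used for all hypotheses, $S_n\subseteq[0,1]$ is the set of possible $p$-values of this test, and $p_j(W)\in S_n$ is the $p$-value for $H_j$ computed from data $W$. Permutations. $\mathcal G$ is the group of all permutations of $\{1,\dots,n\}$, so $|\mathcal G|=n!$; each $g\in\mathcal G$ acts on data matrices, and $gW$ denotes the transformed data (the prototype: the first row of $W$ contains response values $y^{(1)},\dots,y^{(n)}$, row $j+1$ contains the $n$ observations of the $j$th variable, and $gW$ is obtained by permuting the first row). For a real-valued function $f$ of the data, the permutation distribution (depending on $W$) is $$P^*(f(W)\le x)=\frac1{|\mathcal G|}\sum_{g\in\mathcal G}1\{f(gW)\le x\}.$$ Oracle critical value: $$c_{m,n}(\alpha)=\max\Big\{s\in S_n: P_m\Big(\min_{j\in I(P_m)}p_j(W)\le s\Big)\le\alpha\Big\}.$$ Westfall--Young critical value (a random variable depending on $W$): $$\hat c_{m,n}(\alpha)=\max\Big\{s\in S_n: P^*\Big(\min_{j=1,\dots,m}p_j(W)\le s\Big)\le\alpha\Big\}.$$ The maximum of the empty set is defined to be $0$; a maximum of a nonempty set that is not attained (possible for $\hat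 c_{m,n}$ when $S_n=[0,1]$) is read as a supremum. *)

theory Defs
  imports "HOL-Probability.Probability"
begin

text \<open>
  A data matrix is a function of (row, column), extensional on its index set. Its first
  \<open>num_resp\<close> rows contain deterministic responses (there may be none), and row
  \<open>num_resp + j\<close> contains the observations of the \<open>j\<close>-th variable.
\<close>

type_synonym data_matrix = "nat \<times> nat \<Rightarrow> real"

text \<open>
  One multiple testing problem. \<open>law\<close> is the distribution of the random vector
  \<open>(X\<^sub>1, \<dots>, X\<^sub>m)\<close>, \<open>null j\<close> is the null hypothesis \<open>H\<^sub>j\<close>, as a set of distributions, and
  \<open>smp\<close> is the probability space that carries the observations \<open>observation k\<close>.
  \<open>possible_data\<close> is the set over which statements ``for all data'' range; it is in general
  a proper subset of all matrices, since e.g. a constant response row makes every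
  permutation distribution degenerate.
\<close>

record 'a testing_problem =
  num_hyp :: nat
  num_obs :: nat
  num_resp :: nat
  response :: "nat \<Rightarrow> nat \<Rightarrow> real"
  law :: "(nat \<Rightarrow> real) measure"
  null :: "nat \<Rightarrow> (nat \<Rightarrow> real) measure set"
  smp :: "'a measure"
  observation :: "nat \<Rightarrow> 'a \<Rightarrow> nat \<Rightarrow> real"
  possible_data :: "data_matrix set"
  act :: "(nat \<Rightarrow> nat) \<Rightarrow> data_matrix \<Rightarrow> data_matrix"
  pval :: "nat \<Rightarrow> data_matrix \<Rightarrow> real"
  pval_set :: "real set"

definition hyps :: "'a testing_problem \<Rightarrow> nat set" where
  "hyps T = {1..num_hyp T}"

definition true_nulls :: "'a testing_problem \<Rightarrow> nat set" where
  "true_nulls T = {j \<in> hyps T. law T \<in> null T j}"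

definition false_nulls :: "'a testing_problem \<Rightarrow> nat set" where
  "false_nulls T = hyps T - true_nulls T"

definition perms :: "'a testing_problem \<Rightarrow> (nat \<Rightarrow> nat) set" where
  "perms T = {g. g permutes {1..num_obs T}}"

definition matrix_index :: "'a testing_problem \<Rightarrow> (nat \<times> nat) set" where
  "matrix_index T = {1..num_resp T + num_hyp T} \<times> {1..num_obs T}"

definition vector_measure :: "'a testing_problem \<Rightarrow> (nat \<Rightarrow> real) measure" where
  "vector_measure T = (\<Pi>\<^sub>M j\<in>hyps T. borel)"

definition data_space :: "'a testing_problem \<Rightarrow> data_matrix measure" where
  "data_space T = restrict_space (\<Pi>\<^sub>M i\<in>matrix_index T. borel) (possible_data T)"

definition W :: "'a testing_problem \<Rightarrow> 'a \<Rightarrow> data_matrix" where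
  "W T \<omega> = (\<lambda>(i, k)\<in>matrix_index T.
     if i \<le> num_resp T then response T i k else observation T k \<omega> (i - num_resp T))"

text \<open>
  The permutations act from the left, so permuting the columns of the response rows is
  \<open>(i, k) \<mapsto> w (i, inv g k)\<close> for \<open>i \<le> num_resp T\<close>. Group inversion is a bijection of the
  permutation group, so nothing below depends on the choice of side.
\<close>

definition valid_problem :: "'a testing_problem \<Rightarrow> bool" where
  "valid_problem T \<longleftrightarrow>
     num_hyp T \<ge> 1 \<and> num_obs T \<ge> 1 \<and>
     prob_space (smp T) \<and>
     prob_space.indep_vars (smp T) (\<lambda>k. vector_measure T) (observation T) {1..num_obs T} \<and>
     (\<forall>k\<in>{1..num_obs T}. distr (smp T) (vector_measure T) (observation T k) = law T) \<and>
     possible_data T \<subseteq> extensional (matrix_index T) \<and>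
     (\<forall>\<omega>\<in>space (smp T). W T \<omega> \<in> possible_data T) \<and>
     (\<forall>g\<in>perms T. act T g \<in> data_space T \<rightarrow>\<^sub>M data_space T) \<and>
     (\<forall>w\<in>possible_data T. act T id w = w) \<and>
     (\<forall>g\<in>perms T. \<forall>h\<in>perms T. \<forall>w\<in>possible_data T.
        act T (g \<circ> h) w = act T g (act T h w)) \<and>
     pval_set T \<subseteq> {0..1} \<and>
     (\<forall>j\<in>hyps T. pval T j \<in> borel_measurable (data_space T)) \<and>
     (\<forall>j\<in>hyps T. \<forall>w\<in>possible_data T. pval T j w \<in> pval_set T)"

text \<open>The permutation probability \<open>P\<^sup>*(f(W) \<le> x)\<close>, for the data \<open>w\<close>.\<close>

definition perm_prob :: "'a testing_problem \<Rightarrow> (data_matrix \<Rightarrow> real) \<Rightarrow> real \<Rightarrow> data_matrix \<Rightarrow> real" where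
  "perm_prob T f x w =
     1 / real (card (perms T)) * (\<Sum>g\<in>perms T. if f (act T g w) \<le> x then 1 else 0)"

text \<open>
  The maximum of a set, with value \<open>0\<close> for the empty set, and read as a supremum if it is not
  attained (for an attained maximum, \<open>Sup\<close> is the maximum).
\<close>

definition max0 :: "real set \<Rightarrow> real" where
  "max0 A = (if A = {} then 0 else Sup A)"

definition oracle_crit :: "'a testing_problem \<Rightarrow> real \<Rightarrow> real" where
  "oracle_crit T \<alpha> = max0 {s \<in> pval_set T.
     measure (smp T) {\<omega> \<in> space (smp T). (MIN j\<in>true_nulls T. pval T j (W T \<omega>)) \<le> s} \<le> \<alpha>}"

definition wy_crit :: "'a testing_problem \<Rightarrow> real \<Rightarrow> data_matrix \<Rightarrow> real" where
  "wy_crit T \<alpha> w = max0 {s \<in> pval_set T.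
     perm_prob T (\<lambda>v. MIN j\<in>hyps T. pval T j v) s w \<le> \<alpha>}"

end

theory Submission
  imports Defs
begin

text \<open>
  Put \<open>s = c(\<alpha> - \<delta>)\<close>. Independence of the \<open>B\<close> blocks and uniformity of the \<open>p\<close>-values force
  \<open>(1 - s)\<^sup>B \<ge> 1 - (\<alpha> - \<delta>)\<close>, so \<open>s \<le> C / B\<close>; by (B2) and (A2) the false nulls therefore contribute
  only \<open>o(1)\<close> to \<open>P\<^sup>*(min p\<^sub>j \<le> s)\<close>. The contribution of the true nulls has mean at most \<open>\<alpha> - \<delta>\<close>
  by (B1). Its variance is the average over pairs of permutations of the covariance of two minima,
  which (A1) reduces to a sum over blocks; (B2) bounds it by \<open>B (r s max |A\<^sub>b|)\<^sup>2\<close>, and this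
  vanishes by (A3). Chebyshev's inequality gives \<open>P\<^sup>*(min p\<^sub>j \<le> s) \<le> \<alpha>\<close> with probability tending
  to \<open>1\<close>.
\<close>

section \<open>Two elementary facts about real numbers\<close>

text \<open>Factors are exchanged one at a time: all of them lie in \<open>[0, 1]\<close>, so
  exchanging \<open>x b\<close> for \<open>y b\<close> costs at most \<open>v b\<close>. This turns
  a defect of independence within each block into a sum of defects over the blocks.\<close>

lemma prod_le_prod_plus_sum:
  fixes x y v :: "'b \<Rightarrow> real"
  assumes "finite K"
    and "\<And>b. b \<in> K \<Longrightarrow> 0 \<le> x b \<and> x b \<le> 1"
    and "\<And>b. b \<in> K \<Longrightarrow> 0 \<le> y b \<and> y b \<le> 1"
    and "\<And>b. b \<in> K \<Longrightarrow> 0 \<le> v b"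
    and "\<And>b. b \<in> K \<Longrightarrow> x b \<le> y b + v b"
  shows "prod x K \<le> prod y K + sum v K"
  using assms
proof (induction K rule: finite_induct)
  case (insert k K)
  have y: "0 \<le> prod y K" "prod y K \<le> 1"
    using insert.prems by (auto intro!: prod_nonneg prod_le_1)
  have v: "0 \<le> sum v K"
    using insert.prems by (auto intro!: sum_nonneg)
  have k: "0 \<le> x k" "x k \<le> 1" "0 \<le> v k" "x k \<le> y k + v k"
    using insert.prems by auto
  have "x k * prod x K \<le> x k * (prod y K + sum v K)"
    using insert k by (intro mult_left_mono) auto
  also have "\<dots> = x k * prod y K + x k * sum v K"
    by (simp add: algebra_simps)
  also have "\<dots> \<le> (y k + v k) * prod y K + 1 * sum v K"
    using k y v by (intro add_mono mult_right_mono) auto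
  also have "\<dots> \<le> y k * prod y K + v k + sum v K"
    using mult_left_mono[OF y(2) k(3)] by (simp add: algebra_simps)
  finally show ?case
    using insert by (simp add: algebra_simps)
qed simp

text \<open>For each rational with a point of \<open>X\<close> at or below it one such point is
  chosen, and the least element of \<open>X\<close> is added if it exists. A point that is not least
  has a rational strictly between a smaller point and itself, and the choice for that rational lies
  below it. Through this, a union over arbitrarily many thresholds of events that are monotone in
  the threshold becomes countable.\<close>

lemma countable_coinitial_subset:
  fixes X :: "real set"
  obtains D where "countable D" "D \<subseteq> X" "\<And>x. x \<in> X \<Longrightarrow> \<exists>d\<in>D. d \<le> x"
proof
  define f where "f q = (SOME x. x \<in> X \<and> x \<le> q)" for q :: real
  define Q where "Q = {q \<in> \<rat>. \<exists>x\<in>X. x \<le> q}"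
  define L where "L = {x \<in> X. \<forall>y\<in>X. x \<le> y}"
  have f: "f q \<in> X \<and> f q \<le> q" if "q \<in> Q" for q
    unfolding f_def using someI_ex[of "\<lambda>x. x \<in> X \<and> x \<le> q"] that by (auto simp: Q_def)
  have "countable Q"
    unfolding Q_def using countable_rat by (rule countable_subset[rotated]) auto
  moreover have "countable L"
  proof (cases "L = {}")
    case False
    then obtain l where "l \<in> L" by blast
    then have "L \<subseteq> {l}" unfolding L_def by (auto intro: antisym)
    then show ?thesis by (rule countable_subset) simp
  qed simp
  ultimately show "countable (f ` Q \<union> L)" by simp
  show "f ` Q \<union> L \<subseteq> X" using f by (auto simp: L_def)
  fix x assume x: "x \<in> X"
  show "\<exists>d\<in>f ` Q \<union> L. d \<le> x"
  proof (cases "x \<in> L")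
    case False
    then obtain y where y: "y \<in> X" "y < x" using x by (auto simp: L_def not_le)
    then obtain q where q: "q \<in> \<rat>" "y < q" "q < x" using Rats_dense_in_real by blast
    then have "q \<in> Q" using y by (auto simp: Q_def intro!: bexI[of _ y])
    then show ?thesis using f[of q] q by (intro bexI[of _ "f q"]) auto
  qed auto
qed

section \<open>Moments and deviations of averages of indicators\<close>

context prob_space
begin

lemma expectation_sum_indicator:
  assumes "\<And>g. g \<in> G \<Longrightarrow> E g \<in> events"
  shows "expectation (\<lambda>\<omega>. \<Sum>g\<in>G. indicator (E g) \<omega>) = (\<Sum>g\<in>G. prob (E g))"
  using assms by (subst Bochner_Integration.integral_sum) (auto simp: less_top[symmetric])

text \<open>Squaring the average produces a double sum over pairs, which is why joint information
  about two permutations at a time is enough for a variance bound.\<close>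

lemma expectation_square_mean_indicator:
  assumes "finite G" and E: "\<And>g. g \<in> G \<Longrightarrow> E g \<in> events"
  shows "expectation (\<lambda>\<omega>. ((\<Sum>g\<in>G. indicator (E g) \<omega>) / real (card G))\<^sup>2) =
    (\<Sum>g\<in>G. \<Sum>h\<in>G. prob (E g \<inter> E h)) / (real (card G))\<^sup>2"
proof -
  have *: "((\<Sum>g\<in>G. indicator (E g) \<omega>) / real (card G))\<^sup>2 =
      (\<Sum>g\<in>G. \<Sum>h\<in>G. indicator (E g \<inter> E h) \<omega>) / (real (card G))\<^sup>2" for \<omega>
    by (simp add: power_divide power2_eq_square sum_product indicator_inter_arith)
  have [simp]: "E g \<inter> E h \<in> events" if "g \<in> G" "h \<in> G" for g h
    using E that by auto
  then show ?thesis
    unfolding * using expectation_sum_indicator[of "G \<times> G" "\<lambda>(g, h). E g \<inter> E h"]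
    by (simp add: sum.cartesian_product split_beta mem_Times_iff)
qed

text \<open>
  Replacing the joint law of two copies by the product law costs, in each block, at most the
  probability that both copies hit that block; averaged over pairs of copies, this is the second
  moment of the fraction of copies that hit the block, which is at most \<open>c\<^sup>2\<close>.
\<close>

lemma prob_mean_union_deviation:
  fixes U :: "'g \<Rightarrow> 'b \<Rightarrow> 'a set"
  assumes G: "finite G" "G \<noteq> {}" and K: "finite K" "K \<noteq> {}"
    and U: "\<And>g b. g \<in> G \<Longrightarrow> b \<in> K \<Longrightarrow> U g b \<in> events"
    and indep: "\<And>g h. g \<in> G \<Longrightarrow> h \<in> G \<Longrightarrow>
      prob (\<Inter>b\<in>K. space M - (U g b \<union> U h b)) = (\<Prod>b\<in>K. prob (space M - (U g b \<union> U h b)))"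
    and c: "\<And>b \<omega>. b \<in> K \<Longrightarrow> \<omega> \<in> space M \<Longrightarrow>
      (\<Sum>g\<in>G. indicator (U g b) \<omega>) / real (card G) \<le> c"
    and mean: "(\<Sum>g\<in>G. prob (\<Union>b\<in>K. U g b)) / real (card G) \<le> \<mu>"
    and \<epsilon>: "0 < \<epsilon>"
  shows "prob {\<omega> \<in> space M. \<mu> + \<epsilon> \<le> (\<Sum>g\<in>G. indicator (\<Union>b\<in>K. U g b) \<omega>) / real (card G)}
    \<le> real (card K) * c\<^sup>2 / \<epsilon>\<^sup>2"
proof -
  define n where "n = real (card G)"
  have n: "0 < n" using G by (auto simp: n_def card_gt_0_iff)
  \<comment> \<open>The argument runs through the complementary events "copy \<open>g\<close> hits
    no block", because these are intersections over blocks, to which independence applies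
    directly.\<close>
  define V where "V g = (\<Inter>b\<in>K. space M - U g b)" for g
  have V_events: "V g \<in> events" if "g \<in> G" for g
    unfolding V_def using U K that by (intro sets.finite_INT) auto
  have V_compl: "V g = space M - (\<Union>b\<in>K. U g b)" for g
    using K by (auto simp: V_def)
  have union_events: "(\<Union>b\<in>K. U g b) \<in> events" if "g \<in> G" for g
    using U K that by auto
  define N where "N \<omega> = (\<Sum>g\<in>G. indicator (V g) \<omega>) / real (card G)" for \<omega> :: 'a
  define D where "D b \<omega> = (\<Sum>g\<in>G. indicator (U g b) \<omega>) / real (card G)" for b and \<omega> :: 'a
  have N_meas [measurable]: "N \<in> borel_measurable M"
    unfolding N_def using V_events by measurable
  have N_bound: "0 \<le> N \<omega>" "N \<omega> \<le> 1" for \<omega>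
  proof -
    have "(\<Sum>g\<in>G. indicator (V g) \<omega> :: real) \<le> (\<Sum>g\<in>G. 1)"
      by (intro sum_mono) (auto simp: indicator_def)
    then show "N \<omega> \<le> 1" using n by (simp add: N_def n_def divide_simps)
    show "0 \<le> N \<omega>" by (simp add: N_def sum_nonneg)
  qed
  have N_int: "integrable M (\<lambda>\<omega>. (N \<omega>)\<^sup>2)"
    by (rule integrable_const_bound[where B = 1])
      (use N_bound in \<open>auto intro!: power_le_one\<close>)
  have N_int1: "integrable M N"
    by (rule integrable_const_bound[where B = 1]) (use N_bound in auto)
  have EN: "expectation N = (\<Sum>g\<in>G. prob (V g)) / n"
    unfolding N_def n_def using expectation_sum_indicator[of G V] V_events by simp
  have prod_le: "prob (V g \<inter> V h) \<le> prob (V g) * prob (V h) + (\<Sum>b\<in>K. prob (U g b \<inter> U h b))"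
    if "g \<in> G" "h \<in> G" for g h
  proof -
    have "prob (V g \<inter> V h) = prob (\<Inter>b\<in>K. space M - (U g b \<union> U h b))"
      using K by (intro arg_cong[where f = prob]) (auto simp: V_def)
    also have "\<dots> = (\<Prod>b\<in>K. prob (space M - (U g b \<union> U h b)))"
      using indep that by simp
    also have "\<dots> \<le> (\<Prod>b\<in>K. prob (space M - U g b) * prob (space M - U h b)) +
        (\<Sum>b\<in>K. prob (U g b \<inter> U h b))"
    proof (rule prod_le_prod_plus_sum[OF K(1)], goal_cases)
      case (4 b)
      have e: "U g b \<in> events" "U h b \<in> events" using U that 4 by auto
      have "prob (space M - (U g b \<union> U h b)) = 1 - prob (U g b \<union> U h b)"
        using e by (simp add: prob_compl)
      also have "\<dots> = 1 - prob (U g b) - prob (U h b) + prob (U g b \<inter> U h b)"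
        using finite_measure_Union'[OF e(1) e(2)] finite_measure_Diff'[OF e(2) e(1)]
        by (simp add: Int_commute)
      \<comment> \<open>The two sides differ by the nonnegative term
        \<open>prob (U g b) * prob (U h b)\<close>.\<close>
      also have "\<dots> \<le> (1 - prob (U g b)) * (1 - prob (U h b)) + prob (U g b \<inter> U h b)"
        by (simp add: algebra_simps)
      finally show ?case using e by (simp add: prob_compl)
    qed (auto intro!: mult_le_one)
    \<comment> \<open>Taking both members of the pair equal makes the unions collapse, so the
      pairwise hypothesis also gives the product formula for a single copy.\<close>
    also have "(\<Prod>b\<in>K. prob (space M - U g b) * prob (space M - U h b)) = prob (V g) * prob (V h)"
      using indep[of g g] indep[of h h] that by (simp add: prod.distrib V_def)
    finally show ?thesis .
  qed
  \<comment> \<open>The left side is the second moment of \<open>D b\<close>, whose values lie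
    between \<open>0\<close> and \<open>c\<close> on the whole space.\<close>
  have D2: "(\<Sum>g\<in>G. \<Sum>h\<in>G. prob (U g b \<inter> U h b)) / n\<^sup>2 \<le> c\<^sup>2" if "b \<in> K" for b
  proof -
    have "expectation (\<lambda>\<omega>. (D b \<omega>)\<^sup>2) \<le> c\<^sup>2"
    proof (rule integral_le_const)
      have D_bound: "0 \<le> D b \<omega>" "\<omega> \<in> space M \<Longrightarrow> D b \<omega> \<le> c" for \<omega>
        using c[OF that] by (auto simp: D_def sum_nonneg)
      have [measurable]: "D b \<in> borel_measurable M"
        unfolding D_def using U that by measurable
      show "AE \<omega> in M. (D b \<omega>)\<^sup>2 \<le> c\<^sup>2"
        using D_bound by (intro AE_I2 power_mono) auto
      show "integrable M (\<lambda>\<omega>. (D b \<omega>)\<^sup>2)"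
        by (rule integrable_const_bound[where B = "c\<^sup>2"])
          (use D_bound in \<open>auto intro!: power_mono\<close>)
    qed
    then show ?thesis
      unfolding D_def using expectation_square_mean_indicator[OF G(1), of "\<lambda>g. U g b"] U that
      by (simp add: n_def)
  qed
  have "expectation (\<lambda>\<omega>. (N \<omega>)\<^sup>2) = (\<Sum>g\<in>G. \<Sum>h\<in>G. prob (V g \<inter> V h)) / n\<^sup>2"
    unfolding N_def n_def by (rule expectation_square_mean_indicator[OF G(1) V_events])
  also have "\<dots> \<le> (\<Sum>g\<in>G. \<Sum>h\<in>G. prob (V g) * prob (V h) + (\<Sum>b\<in>K. prob (U g b \<inter> U h b))) / n\<^sup>2"
    by (intro divide_right_mono sum_mono prod_le) auto
  also have "\<dots> = (\<Sum>g\<in>G. \<Sum>h\<in>G. prob (V g) * prob (V h)) / n\<^sup>2 +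
      (\<Sum>g\<in>G. \<Sum>h\<in>G. \<Sum>b\<in>K. prob (U g b \<inter> U h b)) / n\<^sup>2"
    by (simp add: sum.distrib add_divide_distrib)
  also have "(\<Sum>g\<in>G. \<Sum>h\<in>G. prob (V g) * prob (V h)) / n\<^sup>2 = (expectation N)\<^sup>2"
    unfolding EN by (simp add: power_divide power2_eq_square sum_product)
  also have "(\<Sum>g\<in>G. \<Sum>h\<in>G. \<Sum>b\<in>K. prob (U g b \<inter> U h b)) / n\<^sup>2 =
      (\<Sum>g\<in>G. \<Sum>b\<in>K. \<Sum>h\<in>G. prob (U g b \<inter> U h b)) / n\<^sup>2"
    by (subst sum.swap) simp
  also have "\<dots> = (\<Sum>b\<in>K. (\<Sum>g\<in>G. \<Sum>h\<in>G. prob (U g b \<inter> U h b)) / n\<^sup>2)"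
    by (subst sum.swap) (simp add: sum_divide_distrib)
  also have "\<dots> \<le> (\<Sum>b\<in>K. c\<^sup>2)"
    by (intro sum_mono D2)
  finally have "expectation (\<lambda>\<omega>. (N \<omega>)\<^sup>2) - (expectation N)\<^sup>2 \<le> real (card K) * c\<^sup>2"
    by simp
  then have var: "variance N \<le> real (card K) * c\<^sup>2"
    using variance_eq[OF N_int1 N_int] by simp
  have EN_ge: "1 - \<mu> \<le> expectation N"
  proof -
    have "(\<Sum>g\<in>G. prob (V g)) = (\<Sum>g\<in>G. 1 - prob (\<Union>b\<in>K. U g b))"
      using union_events by (intro sum.cong) (auto simp: V_compl prob_compl)
    then have "expectation N = 1 - (\<Sum>g\<in>G. prob (\<Union>b\<in>K. U g b)) / n"
      using n unfolding EN by (simp add: sum_subtractf n_def diff_divide_distrib)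
    then show ?thesis using mean by (simp add: n_def)
  qed
  \<comment> \<open>\<open>N\<close> is one minus the fraction of hitting copies and has mean at
    least \<open>1 - \<mu>\<close>, so a fraction of at least \<open>\<mu> + \<epsilon>\<close> puts
    \<open>N\<close> at least \<open>\<epsilon>\<close> below its mean.\<close>
  have "prob {\<omega> \<in> space M. \<mu> + \<epsilon> \<le> (\<Sum>g\<in>G. indicator (\<Union>b\<in>K. U g b) \<omega>) / real (card G)}
      \<le> prob {\<omega> \<in> space M. \<epsilon> \<le> \<bar>N \<omega> - expectation N\<bar>}"
  proof (rule finite_measure_mono)
    show "{\<omega> \<in> space M. \<mu> + \<epsilon> \<le> (\<Sum>g\<in>G. indicator (\<Union>b\<in>K. U g b) \<omega>) / real (card G)}
      \<subseteq> {\<omega> \<in> space M. \<epsilon> \<le> \<bar>N \<omega> - expectation N\<bar>}"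
    proof safe
      fix \<omega> assume \<omega>: "\<omega> \<in> space M"
        and le: "\<mu> + \<epsilon> \<le> (\<Sum>g\<in>G. indicator (\<Union>b\<in>K. U g b) \<omega>) / real (card G)"
      have "(\<Sum>g\<in>G. indicator (V g) \<omega> :: real) = (\<Sum>g\<in>G. 1 - indicator (\<Union>b\<in>K. U g b) \<omega>)"
        using \<omega> by (intro sum.cong) (auto simp: V_compl indicator_def)
      then have "N \<omega> = 1 - (\<Sum>g\<in>G. indicator (\<Union>b\<in>K. U g b) \<omega>) / real (card G)"
        using n unfolding N_def by (simp add: sum_subtractf n_def diff_divide_distrib)
      then show "\<epsilon> \<le> \<bar>N \<omega> - expectation N\<bar>" using le EN_ge by linarith
    qed
  qed measurable
  also have "\<dots> \<le> variance N / \<epsilon>\<^sup>2"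
    using N_int \<epsilon> by (intro Chebyshev_inequality) auto
  also have "\<dots> \<le> real (card K) * c\<^sup>2 / \<epsilon>\<^sup>2"
    using var by (intro divide_right_mono) auto
  finally show ?thesis .
qed

text \<open>The probability of staying strictly below \<open>s\<close> is the left limit at
  \<open>s\<close> of the distribution function, so it inherits any bound valid at all smaller
  thresholds.\<close>

lemma prob_less_le_if_prob_le:
  fixes f :: "'a \<Rightarrow> real"
  assumes f [measurable]: "f \<in> borel_measurable M"
    and le: "\<And>t. t < s \<Longrightarrow> prob {\<omega> \<in> space M. f \<omega> \<le> t} \<le> a"
  shows "prob {\<omega> \<in> space M. f \<omega> < s} \<le> a"
proof -
  let ?\<mu> = "distr M borel f"
  interpret \<mu>: real_distribution ?\<mu>
    by (rule real_distribution_distr) simp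
  have "(cdf ?\<mu> \<longlongrightarrow> measure ?\<mu> {..<s}) (at_left s)"
    by (rule \<mu>.cdf_at_left)
  moreover have "cdf ?\<mu> t \<le> a" if "t < s" for t
  proof -
    have "f -` {..t} \<inter> space M = {\<omega> \<in> space M. f \<omega> \<le> t}" by auto
    then show ?thesis using le[OF that] by (simp add: cdf_def measure_distr)
  qed
  ultimately have "measure ?\<mu> {..<s} \<le> a"
    by (intro tendsto_upperbound) (auto simp: eventually_at_filter)
  moreover have "f -` {..<s} \<inter> space M = {\<omega> \<in> space M. f \<omega> < s}" by auto
  ultimately show ?thesis by (simp add: measure_distr)
qed

end

section \<open>Order properties of \<open>max0\<close> and of permutation probabilities\<close>

lemma max0_nonneg: "0 \<le> max0 X" if "X \<subseteq> {0..}" "bdd_above X"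
proof (cases "X = {}")
  case False
  then obtain x where "x \<in> X" by blast
  then have "x \<le> Sup X" "0 \<le> x" using that by (auto intro: cSup_upper)
  then show ?thesis using False by (simp add: max0_def)
qed (simp add: max0_def)

text \<open>The condition \<open>0 \<le> a\<close> takes care of the default value: for empty
  \<open>X\<close> it makes both sides false.\<close>

lemma less_max0_iff:
  assumes "X \<subseteq> {0..}" "bdd_above X" "0 \<le> a"
  shows "a < max0 X \<longleftrightarrow> (\<exists>x\<in>X. a < x)"
  using assms by (auto simp: max0_def less_cSup_iff)

text \<open>The default value \<open>0\<close> of the empty set fits in because \<open>Y\<close>
  contains only nonnegative numbers.\<close>

lemma max0_mono:
  assumes "X \<subseteq> Y" "Y \<subseteq> {0..}" "bdd_above Y"
  shows "max0 X \<le> max0 Y"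
proof (cases "X = {}")
  case True
  then show ?thesis using max0_nonneg[OF assms(2,3)] by (simp add: max0_def)
next
  case False
  then show ?thesis using assms by (auto simp: max0_def intro: cSup_subset_mono)
qed

lemma perm_prob_mono:
  assumes "x \<le> y"
  shows "perm_prob T f x w \<le> perm_prob T f y w"
  unfolding perm_prob_def using assms by (intro mult_left_mono sum_mono) auto

lemma MIN_le_iff:
  assumes "finite J" "J \<noteq> {}"
  shows "(MIN j\<in>J. f j) \<le> (s :: real) \<longleftrightarrow> (\<exists>j\<in>J. f j \<le> s)"
  using assms by (simp add: Min_le_iff)

lemma less_MIN_iff:
  assumes "finite J" "J \<noteq> {}"
  shows "(s :: real) < (MIN j\<in>J. f j) \<longleftrightarrow> (\<forall>j\<in>J. s < f j)"
  using assms by simp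

section \<open>A single testing problem with independent blocks, and its measurability\<close>

text \<open>The non-asymptotic content of (A1), (B1) and (B3) for one problem. The bounds derived
  here are explicit, so that the limit can be taken afterwards by inserting (A2), (A3) and
  (B2).\<close>

locale block_problem =
  fixes T :: "'a testing_problem" and A :: "'b \<Rightarrow> nat set" and K :: "'b set"
  assumes valid: "valid_problem T"
    and finite_K: "finite K"
    and cover: "(\<Union>b\<in>K. A b) = hyps T"
    and nulls: "\<And>b. b \<in> K \<Longrightarrow> A b \<inter> true_nulls T \<noteq> {}"
    and indep: "\<And>g g'. g \<in> perms T \<Longrightarrow> g' \<in> perms T \<Longrightarrow>
      prob_space.indep_vars (smp T) (\<lambda>b. borel)
        (\<lambda>b \<omega>. MIN h\<in>{g, g'}. MIN j\<in>A b \<inter> true_nulls T. pval T j (act T h (W T \<omega>))) K"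
    and invariant:
      "distr (smp T) (\<Pi>\<^sub>M j\<in>true_nulls T. borel) (\<lambda>\<omega>. \<lambda>j\<in>true_nulls T. pval T j (W T \<omega>)) =
      distr (smp T \<Otimes>\<^sub>M uniform_count_measure (perms T)) (\<Pi>\<^sub>M j\<in>true_nulls T. borel)
        (\<lambda>(\<omega>, G). \<lambda>j\<in>true_nulls T. pval T j (act T G (W T \<omega>)))"
    and uniform: "\<And>j s. j \<in> true_nulls T \<Longrightarrow> s \<in> pval_set T \<Longrightarrow>
      measure (smp T) {\<omega> \<in> space (smp T). pval T j (W T \<omega>) \<le> s} = s"
begin

sublocale prob_space "smp T"
  using valid by (simp add: valid_problem_def)

lemma finite_hyps: "finite (hyps T)" and hyps_nonempty: "hyps T \<noteq> {}"
  using valid by (auto simp: hyps_def valid_problem_def)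

lemma true_nulls_subset: "true_nulls T \<subseteq> hyps T"
  by (auto simp: true_nulls_def)

lemma finite_true_nulls: "finite (true_nulls T)"
  using finite_subset[OF true_nulls_subset finite_hyps] .

lemma K_nonempty: "K \<noteq> {}"
  using cover hyps_nonempty by auto

lemma true_nulls_nonempty: "true_nulls T \<noteq> {}"
  using nulls K_nonempty by blast

lemma true_nulls_blocks: "true_nulls T = (\<Union>b\<in>K. A b \<inter> true_nulls T)"
  using cover true_nulls_subset by auto

lemma finite_perms: "finite (perms T)"
  by (simp add: perms_def finite_permutations)

lemma id_perms: "id \<in> perms T"
  by (simp add: perms_def permutes_id)

lemma act_id: "\<omega> \<in> space (smp T) \<Longrightarrow> act T id (W T \<omega>) = W T \<omega>"
  using valid by (auto simp: valid_problem_def)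

lemma W_possible: "\<omega> \<in> space (smp T) \<Longrightarrow> W T \<omega> \<in> possible_data T"
  using valid by (auto simp: valid_problem_def)

lemma pval_set_bounds: "X \<subseteq> pval_set T \<Longrightarrow> X \<subseteq> {0..}" "X \<subseteq> pval_set T \<Longrightarrow> bdd_above X"
proof -
  have *: "pval_set T \<subseteq> {0..1}" using valid by (simp add: valid_problem_def)
  show "X \<subseteq> pval_set T \<Longrightarrow> X \<subseteq> {0..}" using * by auto
  show "X \<subseteq> pval_set T \<Longrightarrow> bdd_above X"
    using * by (meson bdd_above_Icc bdd_above_mono)
qed

lemma W_measurable: "W T \<in> smp T \<rightarrow>\<^sub>M data_space T"
  unfolding data_space_def
proof (rule measurable_restrict_space2)
  show "W T \<in> space (smp T) \<rightarrow> possible_data T"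
    using W_possible by auto
  \<comment> \<open>Measurability of the observations is contained in
    \<open>indep_vars\<close>.\<close>
  have obs: "observation T k \<in> smp T \<rightarrow>\<^sub>M vector_measure T" if "k \<in> {1..num_obs T}" for k
    using valid that by (auto simp: valid_problem_def indep_vars_def)
  have comp: "(\<lambda>\<omega>. observation T k \<omega> j) \<in> borel_measurable (smp T)"
    if "k \<in> {1..num_obs T}" "j \<in> hyps T" for j k
    using measurable_compose[OF obs[OF that(1), unfolded vector_measure_def]
      measurable_component_singleton[OF that(2)]] by simp
  show "W T \<in> smp T \<rightarrow>\<^sub>M (\<Pi>\<^sub>M i\<in>matrix_index T. borel)"
    unfolding W_def
  proof (rule measurable_restrict)
    fix ik assume ik: "ik \<in> matrix_index T"
    obtain i k where [simp]: "ik = (i, k)" by (cases ik)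
    have "i - num_resp T \<in> hyps T" if "\<not> i \<le> num_resp T"
      using ik that by (auto simp: matrix_index_def hyps_def)
    then show "(\<lambda>\<omega>. case ik of (i, k) \<Rightarrow> if i \<le> num_resp T then response T i k
        else observation T k \<omega> (i - num_resp T)) \<in> borel_measurable (smp T)"
      using ik comp[of k "i - num_resp T"]
      by (cases "i \<le> num_resp T") (auto simp: matrix_index_def)
  qed
qed

lemma act_measurable: "g \<in> perms T \<Longrightarrow> (\<lambda>\<omega>. act T g (W T \<omega>)) \<in> smp T \<rightarrow>\<^sub>M data_space T"
  using valid by (intro measurable_compose[OF W_measurable]) (auto simp: valid_problem_def)

lemma pval_measurable:
  "j \<in> hyps T \<Longrightarrow> g \<in> perms T \<Longrightarrow>
    (\<lambda>\<omega>. pval T j (act T g (W T \<omega>))) \<in> borel_measurable (smp T)"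
  using valid
  by (intro measurable_compose[OF act_measurable, of g "pval T j" borel]) (auto simp: valid_problem_def)

lemma pval_measurable_id:
  "j \<in> hyps T \<Longrightarrow> (\<lambda>\<omega>. pval T j (W T \<omega>)) \<in> borel_measurable (smp T)"
  using valid
  by (intro measurable_compose[OF W_measurable, of "pval T j" borel]) (auto simp: valid_problem_def)

lemma hit_events [measurable]:
  assumes "J \<subseteq> hyps T" "g \<in> perms T"
  shows "{\<omega> \<in> space (smp T). \<exists>j\<in>J. pval T j (act T g (W T \<omega>)) \<le> s} \<in> events"
proof -
  have "finite J" using assms finite_hyps finite_subset by blast
  moreover have "{\<omega> \<in> space (smp T). pval T j (act T g (W T \<omega>)) \<le> s} \<in> events" if "j \<in> J" for j
    using pval_measurable[of j g] assms that by (auto intro!: borel_measurable_le)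
  ultimately show ?thesis by (intro sets.sets_Collect_finite_Ex) auto
qed

lemma perm_prob_measurable:
  "(\<lambda>\<omega>. perm_prob T (\<lambda>v. MIN j\<in>hyps T. pval T j v) s (W T \<omega>)) \<in> borel_measurable (smp T)"
proof -
  have [measurable]: "(\<lambda>\<omega>. MIN j\<in>hyps T. pval T j (act T g (W T \<omega>))) \<in> borel_measurable (smp T)"
    if "g \<in> perms T" for g
    using finite_hyps pval_measurable that by (intro borel_measurable_Min) auto
  show ?thesis unfolding perm_prob_def by measurable
qed

text \<open>
  The set of possible \<open>p\<close>-values is arbitrary, possibly not Borel. As the permutation probability
  is monotone in the threshold, countably many thresholds suffice.
\<close>

lemma wy_crit_measurable: "(\<lambda>\<omega>. wy_crit T \<alpha> (W T \<omega>)) \<in> borel_measurable (smp T)"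
proof (subst borel_measurable_iff_greater, intro allI)
  fix a :: real
  let ?P = "\<lambda>t \<omega>. perm_prob T (\<lambda>v. MIN j\<in>hyps T. pval T j v) t (W T \<omega>)"
  have nonneg: "0 \<le> wy_crit T \<alpha> w" for w
    unfolding wy_crit_def by (intro max0_nonneg pval_set_bounds) auto
  show "{\<omega> \<in> space (smp T). a < wy_crit T \<alpha> (W T \<omega>)} \<in> events"
  \<comment> \<open>Critical values are nonnegative, so negative \<open>a\<close> gives the whole
    space; \<open>less_max0_iff\<close> covers the remaining \<open>a\<close>.\<close>
  proof (cases "a < 0")
    case True
    then have "{\<omega> \<in> space (smp T). a < wy_crit T \<alpha> (W T \<omega>)} = space (smp T)"
      using nonneg by (auto intro: less_le_trans)
    then show ?thesis by simp
  next
    case False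
    \<comment> \<open>If some threshold above \<open>a\<close> is admissible, then so is every
      member of \<open>D\<close> at or below it, since lowering the threshold lowers the permutation
      probability.\<close>
    obtain D where D: "countable D" "D \<subseteq> {t \<in> pval_set T. a < t}"
      "\<And>t. t \<in> {t \<in> pval_set T. a < t} \<Longrightarrow> \<exists>d\<in>D. d \<le> t"
      using countable_coinitial_subset[of "{t \<in> pval_set T. a < t}"] by blast
    have "a < wy_crit T \<alpha> (W T \<omega>) \<longleftrightarrow> (\<exists>t\<in>D. ?P t \<omega> \<le> \<alpha>)" for \<omega>
    proof -
      have "a < wy_crit T \<alpha> (W T \<omega>) \<longleftrightarrow> (\<exists>t\<in>{t \<in> pval_set T. ?P t \<omega> \<le> \<alpha>}. a < t)"
        unfolding wy_crit_def using False by (intro less_max0_iff pval_set_bounds) auto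
      also have "\<dots> \<longleftrightarrow> (\<exists>t\<in>D. ?P t \<omega> \<le> \<alpha>)"
      proof
        assume "\<exists>t\<in>{t \<in> pval_set T. ?P t \<omega> \<le> \<alpha>}. a < t"
        then obtain t where t: "t \<in> pval_set T" "a < t" "?P t \<omega> \<le> \<alpha>" by auto
        then obtain d where "d \<in> D" "d \<le> t" using D(3) by blast
        then show "\<exists>t\<in>D. ?P t \<omega> \<le> \<alpha>"
          using t perm_prob_mono order_trans by meson
      qed (use D(2) in auto)
      finally show ?thesis .
    qed
    then have "{\<omega> \<in> space (smp T). a < wy_crit T \<alpha> (W T \<omega>)} =
        (\<Union>t\<in>D. {\<omega> \<in> space (smp T). ?P t \<omega> \<le> \<alpha>})"
      by auto
    also have "\<dots> \<in> events"
      using D(1) perm_prob_measurable by (intro sets.countable_UN') (auto intro!: borel_measurable_le)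
    finally show ?thesis .
  qed
qed

section \<open>Consequences of invariance and of block independence\<close>

text \<open>The average on the left is the probability of a hit after a uniformly random
  permutation. By (B1) such a permutation does not change the joint law of the null
  \<open>p\<close>-values.\<close>

lemma mean_null_hit:
  "(\<Sum>g\<in>perms T. prob {\<omega> \<in> space (smp T). \<exists>j\<in>true_nulls T. pval T j (act T g (W T \<omega>)) \<le> s})
      / real (card (perms T))
    = prob {\<omega> \<in> space (smp T). \<exists>j\<in>true_nulls T. pval T j (W T \<omega>) \<le> s}"
proof -
  let ?U = "uniform_count_measure (perms T)"
  let ?I = "true_nulls T"
  let ?R = "\<Pi>\<^sub>M j\<in>?I. (borel :: real measure)"
  let ?E = "\<lambda>g. {\<omega> \<in> space (smp T). \<exists>j\<in>?I. pval T j (act T g (W T \<omega>)) \<le> s}"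
  let ?f = "\<lambda>(\<omega>, G). \<lambda>j\<in>?I. pval T j (act T G (W T \<omega>))"
  interpret U: prob_space ?U
    using finite_perms id_perms by (intro prob_space_uniform_count_measure) auto
  interpret Q: pair_prob_space "smp T" ?U ..
  have E: "?E g \<in> events" if "g \<in> perms T" for g
    using hit_events[OF true_nulls_subset that] .
  \<comment> \<open>Both hit probabilities are the mass of this one set, under the two laws that
    \<open>invariant\<close> equates.\<close>
  define S where "S = {x \<in> space ?R. \<exists>j\<in>?I. x j \<le> s}"
  have S: "S \<in> sets ?R"
  proof -
    have "{x \<in> space ?R. x j \<le> s} \<in> sets ?R" if "j \<in> ?I" for j
      using that by measurable
    then show ?thesis
      unfolding S_def using finite_true_nulls by (intro sets.sets_Collect_finite_Ex) auto
  qed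
  have m1: "(\<lambda>\<omega>. \<lambda>j\<in>?I. pval T j (W T \<omega>)) \<in> smp T \<rightarrow>\<^sub>M ?R"
    using pval_measurable_id true_nulls_subset by (intro measurable_restrict) auto
  have m2: "?f \<in> smp T \<Otimes>\<^sub>M ?U \<rightarrow>\<^sub>M ?R"
  proof -
    \<comment> \<open>As there are only finitely many permutations, measurability for each fixed
      permutation yields joint measurability.\<close>
    have "?f \<in> smp T \<Otimes>\<^sub>M count_space (perms T) \<rightarrow>\<^sub>M ?R"
    proof (rule measurable_compose_countable'[where f = "\<lambda>g x. ?f (fst x, g)" and g = snd
          and I = "perms T", simplified])
      show "(\<lambda>x. \<lambda>j\<in>?I. pval T j (act T g (W T (fst x))))
          \<in> smp T \<Otimes>\<^sub>M count_space (perms T) \<rightarrow>\<^sub>M ?R" if "g \<in> perms T" for g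
        using pval_measurable true_nulls_subset that
        by (intro measurable_restrict measurable_compose[OF measurable_fst]) auto
    qed (use finite_perms in \<open>auto intro: countable_finite\<close>)
    then show ?thesis
      by (subst measurable_cong_sets[OF sets_pair_measure_cong refl])
        (auto simp: sets_uniform_count_measure)
  qed
  have "prob {\<omega> \<in> space (smp T). \<exists>j\<in>?I. pval T j (W T \<omega>) \<le> s} =
      measure (distr (smp T) ?R (\<lambda>\<omega>. \<lambda>j\<in>?I. pval T j (W T \<omega>))) S"
    using m1 S by (subst measure_distr)
      (auto simp: S_def space_PiM intro!: arg_cong[where f = prob])
  also have "\<dots> = measure (smp T \<Otimes>\<^sub>M ?U) (?f -` S \<inter> space (smp T \<Otimes>\<^sub>M ?U))"
    unfolding invariant using m2 S by (rule measure_distr)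
  also have "?f -` S \<inter> space (smp T \<Otimes>\<^sub>M ?U) = (\<Union>g\<in>perms T. ?E g \<times> {g})"
    by (auto simp: S_def space_PiM space_pair_measure space_uniform_count_measure)
  also have "measure (smp T \<Otimes>\<^sub>M ?U) \<dots> = (\<Sum>g\<in>perms T. measure (smp T \<Otimes>\<^sub>M ?U) (?E g \<times> {g}))"
    using E finite_perms
    by (intro Q.finite_measure_finite_Union)
      (auto simp: disjoint_family_on_def sets_uniform_count_measure intro!: pair_measureI)
  also have "\<dots> = (\<Sum>g\<in>perms T. prob (?E g) * (1 / real (card (perms T))))"
  proof (intro sum.cong refl)
    fix g assume g: "g \<in> perms T"
    have "emeasure (smp T \<Otimes>\<^sub>M ?U) (?E g \<times> {g}) = emeasure (smp T) (?E g) * emeasure ?U {g}"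
      using E g by (intro U.emeasure_pair_measure_Times) (auto simp: sets_uniform_count_measure)
    then show "measure (smp T \<Otimes>\<^sub>M ?U) (?E g \<times> {g}) = prob (?E g) * (1 / real (card (perms T)))"
      using g finite_perms by (simp add: measure_def enn2real_mult emeasure_uniform_count_measure)
  qed
  finally show ?thesis by (simp add: sum_divide_distrib)
qed

text \<open>A block avoids the level \<open>s\<close> under both permutations exactly when its
  minimum over the pair exceeds \<open>s\<close>. The formula is therefore the independence of these
  minima, tested on the ray \<open>{s<..}\<close>.\<close>

lemma block_independence:
  fixes s :: real
  assumes g: "g \<in> perms T" "h \<in> perms T"
  defines "U \<equiv> \<lambda>g b. {\<omega> \<in> space (smp T). \<exists>j\<in>A b \<inter> true_nulls T. pval T j (act T g (W T \<omega>)) \<le> s}"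
  shows "prob (\<Inter>b\<in>K. space (smp T) - (U g b \<union> U h b)) =
    (\<Prod>b\<in>K. prob (space (smp T) - (U g b \<union> U h b)))"
proof -
  let ?X = "\<lambda>b \<omega>. MIN h\<in>{g, h}. MIN j\<in>A b \<inter> true_nulls T. pval T j (act T h (W T \<omega>))"
  have *: "?X b -` {s<..} \<inter> space (smp T) = space (smp T) - (U g b \<union> U h b)" if "b \<in> K" for b
  proof -
    have "s < ?X b \<omega> \<longleftrightarrow> (\<forall>j\<in>A b \<inter> true_nulls T.
        s < pval T j (act T g (W T \<omega>)) \<and> s < pval T j (act T h (W T \<omega>)))" for \<omega>
      using finite_true_nulls nulls[OF that]
      by (simp add: less_MIN_iff ball_conj_distrib del: Min_gr_iff)
    then have "?X b -` {s<..} \<inter> space (smp T) = {\<omega> \<in> space (smp T). \<forall>j\<in>A b \<inter> true_nulls T.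
        s < pval T j (act T g (W T \<omega>)) \<and> s < pval T j (act T h (W T \<omega>))}"
      by (simp only: vimage_def greaterThan_iff) blast
    also have "\<dots> = space (smp T) - (U g b \<union> U h b)"
      by (auto simp: U_def simp flip: not_less)
    finally show ?thesis .
  qed
  have "prob (\<Inter>b\<in>K. space (smp T) - (U g b \<union> U h b)) = prob (\<Inter>b\<in>K. ?X b -` {s<..} \<inter> space (smp T))"
    by (rule arg_cong[where f = prob], rule INF_cong[OF refl], rule *[symmetric])
  also have "\<dots> = (\<Prod>b\<in>K. prob (?X b -` {s<..} \<inter> space (smp T)))"
    by (rule indep_varsD_finite[OF indep[OF g] K_nonempty finite_K]) simp
  also have "\<dots> = (\<Prod>b\<in>K. prob (space (smp T) - (U g b \<union> U h b)))"
    by (rule prod.cong[OF refl], rule arg_cong[where f = prob], rule *)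
  finally show ?thesis .
qed

section \<open>Size and level of the oracle critical value\<close>

context
  fixes a s :: real and X :: "real set"
  assumes a: "0 < a" "a < 1"
  defines "s \<equiv> oracle_crit T a"
    and "X \<equiv> {t \<in> pval_set T. prob {\<omega> \<in> space (smp T). \<exists>j\<in>true_nulls T. pval T j (W T \<omega>) \<le> t} \<le> a}"
begin

lemma oracle_crit_eq: "s = max0 X"
  unfolding s_def X_def oracle_crit_def
  using finite_true_nulls true_nulls_nonempty by (simp add: MIN_le_iff)

lemma oracle_set_bounds: "X \<subseteq> {0..}" "bdd_above X"
  using pval_set_bounds[of X] by (auto simp: X_def)

lemma oracle_crit_nonneg: "0 \<le> s"
  unfolding oracle_crit_eq using oracle_set_bounds by (rule max0_nonneg)

text \<open>Each block contains a uniform null \<open>p\<close>-value and so avoids the level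
  \<open>t\<close> with probability at most \<open>1 - t \<le> exp (- t)\<close>. By independence
  all blocks avoid it with probability at most \<open>exp (- t * card K)\<close>, while
  admissibility of \<open>t\<close> makes this probability at least \<open>1 - a\<close>.\<close>

lemma oracle_level_bound:
  assumes t: "t \<in> X"
  shows "t * real (card K) \<le> - ln (1 - a)"
proof -
  let ?E = "\<lambda>J. {\<omega> \<in> space (smp T). \<exists>j\<in>J. pval T j (W T \<omega>) \<le> t}"
  \<comment> \<open>The unpermuted event is rewritten with the identity permutation so that
    \<open>block_independence\<close> applies to the pair \<open>id\<close>,
    \<open>id\<close>.\<close>
  let ?F = "\<lambda>b. {\<omega> \<in> space (smp T). \<exists>j\<in>A b \<inter> true_nulls T. pval T j (act T id (W T \<omega>)) \<le> t}"
  have EF: "?F b = ?E (A b \<inter> true_nulls T)" for b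
    using act_id by auto
  have ev: "?E J \<in> events" if "J \<subseteq> true_nulls T" for J
    using hit_events[OF order_trans[OF that true_nulls_subset] id_perms, of t] act_id
    by (simp cong: conj_cong)
  have block: "prob (space (smp T) - ?E (A b \<inter> true_nulls T)) \<le> 1 - t" if b: "b \<in> K" for b
  proof -
    obtain j where j: "j \<in> A b" "j \<in> true_nulls T" using nulls[OF b] by auto
    have "t = prob {\<omega> \<in> space (smp T). pval T j (W T \<omega>) \<le> t}"
      using uniform[OF j(2)] t by (simp add: X_def)
    also have "\<dots> \<le> prob (?E (A b \<inter> true_nulls T))"
      using j by (intro finite_measure_mono ev) auto
    finally show ?thesis using ev by (simp add: prob_compl)
  qed
  have "1 - a \<le> prob (space (smp T) - ?E (true_nulls T))"
    using t ev by (simp add: prob_compl X_def)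
  also have "space (smp T) - ?E (true_nulls T) = (\<Inter>b\<in>K. space (smp T) - (?F b \<union> ?F b))"
    using K_nonempty unfolding EF by (subst true_nulls_blocks) auto
  also have "prob \<dots> = (\<Prod>b\<in>K. prob (space (smp T) - (?F b \<union> ?F b)))"
    using block_independence[OF id_perms id_perms] .
  also have "\<dots> \<le> (\<Prod>b\<in>K. exp (- t))"
  proof (intro prod_mono conjI)
    fix b assume "b \<in> K"
    then have "prob (space (smp T) - (?F b \<union> ?F b)) \<le> 1 - t" using block unfolding EF by simp
    also have "\<dots> \<le> exp (- t)" using exp_ge_add_one_self[of "- t"] by simp
    finally show "prob (space (smp T) - (?F b \<union> ?F b)) \<le> exp (- t)" .
  qed simp
  also have "\<dots> = exp (- (t * real (card K)))"
    by (simp add: exp_of_nat_mult[symmetric] mult.commute)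
  finally have "ln (1 - a) \<le> - (t * real (card K))"
    using a ln_le_cancel_iff[of "1 - a" "exp (- (t * real (card K)))"] by simp
  then show ?thesis by simp
qed

text \<open>The bound on each admissible level passes to the supremum; for an empty set the default
  value \<open>0\<close> satisfies it because \<open>- ln (1 - a)\<close> is positive.\<close>

lemma oracle_crit_bound: "s * real (card K) \<le> - ln (1 - a)"
proof (cases "X = {}")
  case True
  then show ?thesis using a by (simp add: oracle_crit_eq max0_def)
next
  case False
  have K: "0 < real (card K)" using K_nonempty finite_K by (simp add: card_gt_0_iff)
  have "Sup X \<le> - ln (1 - a) / real (card K)"
    using oracle_level_bound K by (intro cSup_least[OF False], subst pos_le_divide_eq)
  then have "Sup X * real (card K) \<le> - ln (1 - a)"
    using K by (subst (asm) pos_le_divide_eq)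
  then show ?thesis using False by (simp add: oracle_crit_eq max0_def)
qed

text \<open>
  If the supremum \<open>s\<close> is not attained, then no null \<open>p\<close>-value has an atom at \<open>s\<close>, so the level
  passes to the limit.
\<close>

lemma oracle_crit_level:
  assumes "X \<noteq> {}"
  shows "prob {\<omega> \<in> space (smp T). \<exists>j\<in>true_nulls T. pval T j (W T \<omega>) \<le> s} \<le> a"
proof (cases "s \<in> X")
  case True
  then show ?thesis by (simp add: X_def)
next
  case False
  have s: "s = Sup X" using assms by (simp add: oracle_crit_eq max0_def)
  let ?I = "true_nulls T"
  let ?m = "\<lambda>\<omega>. MIN j\<in>?I. pval T j (W T \<omega>)"
  have m [measurable]: "?m \<in> borel_measurable (smp T)"
    using finite_true_nulls pval_measurable_id true_nulls_subset by (intro borel_measurable_Min) auto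
  have p [measurable]: "(\<lambda>\<omega>. pval T j (W T \<omega>)) \<in> borel_measurable (smp T)" if "j \<in> ?I" for j
    using pval_measurable_id true_nulls_subset that by auto
  have m_less: "?m \<omega> < s \<longleftrightarrow> (\<exists>j\<in>?I. pval T j (W T \<omega>) < s)" for \<omega>
    using finite_true_nulls true_nulls_nonempty by (simp add: Min_less_iff)
  have less: "prob {\<omega> \<in> space (smp T). ?m \<omega> < s} \<le> a"
  proof (rule prob_less_le_if_prob_le[OF m])
    fix t assume "t < s"
    then obtain x where x: "x \<in> X" "t < x"
      using assms oracle_set_bounds by (auto simp: s less_cSup_iff)
    have "prob {\<omega> \<in> space (smp T). ?m \<omega> \<le> t} \<le> prob {\<omega> \<in> space (smp T). ?m \<omega> \<le> x}"
      using x by (intro finite_measure_mono) auto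
    also have "\<dots> \<le> a"
      using x finite_true_nulls true_nulls_nonempty by (simp add: X_def MIN_le_iff)
    finally show "prob {\<omega> \<in> space (smp T). ?m \<omega> \<le> t} \<le> a" .
  qed
  \<comment> \<open>If \<open>s\<close> is a possible \<open>p\<close>-value, (B3) at
    \<open>s\<close> and at any \<open>t\<close> in \<open>X\<close> bounds the atom by
    \<open>s - t\<close>, and \<open>t\<close> comes arbitrarily close to \<open>s\<close>.
    Otherwise the \<open>p\<close>-value never equals \<open>s\<close>.\<close>
  have atom: "prob {\<omega> \<in> space (smp T). pval T j (W T \<omega>) = s} = 0" if j: "j \<in> ?I" for j
  proof (cases "s \<in> pval_set T")
    case True
    note [measurable] = p[OF j]
    have "prob {\<omega> \<in> space (smp T). pval T j (W T \<omega>) = s} \<le> s - t" if t: "t \<in> X" for t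
    proof -
      have "t < s"
        using t False oracle_set_bounds cSup_upper[of t X] by (cases "t = s") (auto simp: s)
      have "prob {\<omega> \<in> space (smp T). pval T j (W T \<omega>) = s} \<le>
          prob ({\<omega> \<in> space (smp T). pval T j (W T \<omega>) \<le> s} - {\<omega> \<in> space (smp T). pval T j (W T \<omega>) \<le> t})"
        using \<open>t < s\<close> by (intro finite_measure_mono) auto
      also have "\<dots> = s - t"
        using \<open>t < s\<close> uniform[OF j] True t by (subst finite_measure_Diff) (auto simp: X_def)
      finally show ?thesis .
    qed
    \<comment> \<open>The bounds say that \<open>s\<close> minus the mass of the atom is an upper
      bound of \<open>X\<close>, hence at least its supremum \<open>s\<close>.\<close>
    then have "s \<le> s - prob {\<omega> \<in> space (smp T). pval T j (W T \<omega>) = s}"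
      using assms by (subst s, intro cSup_least) force+
    then show ?thesis by (simp add: measure_le_0_iff)
  next
    case False
    then have "{\<omega> \<in> space (smp T). pval T j (W T \<omega>) = s} = {}"
      using valid j true_nulls_subset by (auto simp: valid_problem_def)
    then show ?thesis by (simp only: measure_empty)
  qed
  have "prob {\<omega> \<in> space (smp T). \<exists>j\<in>?I. pval T j (W T \<omega>) \<le> s} \<le>
      prob ({\<omega> \<in> space (smp T). ?m \<omega> < s} \<union> (\<Union>j\<in>?I. {\<omega> \<in> space (smp T). pval T j (W T \<omega>) = s}))"
  proof (rule finite_measure_mono)
    show "{\<omega> \<in> space (smp T). ?m \<omega> < s} \<union> (\<Union>j\<in>?I. {\<omega> \<in> space (smp T). pval T j (W T \<omega>) = s}) \<in> events"
      using finite_true_nulls by (intro sets.Un sets.finite_UN) measurable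
  qed (simp only: m_less, auto simp: less_le)
  also have "\<dots> \<le> prob {\<omega> \<in> space (smp T). ?m \<omega> < s} +
      prob (\<Union>j\<in>?I. {\<omega> \<in> space (smp T). pval T j (W T \<omega>) = s})"
    using finite_true_nulls by (intro measure_Un_le sets.finite_UN) measurable
  also have "\<dots> \<le> a + (\<Sum>j\<in>?I. prob {\<omega> \<in> space (smp T). pval T j (W T \<omega>) = s})"
    using finite_true_nulls by (intro add_mono less finite_measure_subadditive_finite) auto
  finally show ?thesis using atom by simp
qed

end

section \<open>Comparison of the oracle and Westfall-Young critical values\<close>

text \<open>A union bound for fixed data: the hit indicator of \<open>J\<close> is at most the sum
  of the indicators of its members, and exchanging the sums gives the individual permutation
  probabilities.\<close>

lemma hit_fraction_le:
  assumes J: "J \<subseteq> hyps T" and \<omega>: "\<omega> \<in> space (smp T)"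
    and c: "\<And>j. j \<in> J \<Longrightarrow> perm_prob T (pval T j) s (W T \<omega>) \<le> c"
  shows "(\<Sum>g\<in>perms T. indicator {\<omega> \<in> space (smp T). \<exists>j\<in>J. pval T j (act T g (W T \<omega>)) \<le> s} \<omega>)
    / real (card (perms T)) \<le> real (card J) * c"
proof -
  have fin: "finite J" using J finite_hyps finite_subset by blast
  let ?i = "\<lambda>j g. if pval T j (act T g (W T \<omega>)) \<le> s then 1 else 0 :: real"
  have "indicator {\<omega> \<in> space (smp T). \<exists>j\<in>J. pval T j (act T g (W T \<omega>)) \<le> s} \<omega> \<le> (\<Sum>j\<in>J. ?i j g)"
    for g
  proof (cases "\<exists>j\<in>J. pval T j (act T g (W T \<omega>)) \<le> s")
    case True
    then obtain j where j: "j \<in> J" "pval T j (act T g (W T \<omega>)) \<le> s" by blast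
    then have "1 \<le> (\<Sum>j\<in>J. ?i j g)"
      using member_le_sum[of j J "\<lambda>j. ?i j g"] fin by simp
    then show ?thesis by (auto simp: indicator_def)
  qed (auto simp: indicator_def intro!: sum_nonneg)
  then have "(\<Sum>g\<in>perms T. indicator {\<omega> \<in> space (smp T). \<exists>j\<in>J. pval T j (act T g (W T \<omega>)) \<le> s} \<omega>)
      / real (card (perms T)) \<le> (\<Sum>g\<in>perms T. \<Sum>j\<in>J. ?i j g) / real (card (perms T))"
    by (intro divide_right_mono sum_mono) auto
  also have "\<dots> = (\<Sum>j\<in>J. perm_prob T (pval T j) s (W T \<omega>))"
    by (subst sum.swap) (simp add: perm_prob_def sum_divide_distrib)
  also have "\<dots> \<le> real (card J) * c"
    using c by (rule sum_bounded_above)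
  finally show ?thesis .
qed

text \<open>The sets of admissible levels are compared, since an unattained supremum need not be a
  possible \<open>p\<close>-value itself. Every oracle level is at most the supremum, so
  monotonicity of \<open>perm_prob\<close> makes it admissible for Westfall-Young. A zero oracle
  value is dominated because \<open>max0\<close> is nonnegative here.\<close>

lemma oracle_le_wy_crit:
  assumes "oracle_crit T a = 0 \<or>
    perm_prob T (\<lambda>v. MIN j\<in>hyps T. pval T j v) (oracle_crit T a) w \<le> \<alpha>"
  shows "oracle_crit T a \<le> wy_crit T \<alpha> w"
proof -
  define Y where "Y = {t \<in> pval_set T. perm_prob T (\<lambda>v. MIN j\<in>hyps T. pval T j v) t w \<le> \<alpha>}"
  define X where "X = {t \<in> pval_set T.
    prob {\<omega> \<in> space (smp T). (MIN j\<in>true_nulls T. pval T j (W T \<omega>)) \<le> t} \<le> a}"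
  have X: "X \<subseteq> {0..}" "bdd_above X" and Y: "Y \<subseteq> {0..}" "bdd_above Y"
    by (auto simp: X_def Y_def intro!: pval_set_bounds dest: pval_set_bounds(1)[THEN subsetD, OF subset_refl])
  have o: "oracle_crit T a = max0 X" by (simp add: oracle_crit_def X_def)
  show ?thesis
  proof (cases "oracle_crit T a = 0")
    case True
    then show ?thesis using max0_nonneg[OF Y] by (simp add: wy_crit_def Y_def)
  next
    case False
    then have s: "oracle_crit T a = Sup X" by (auto simp: o max0_def)
    have "X \<subseteq> Y"
    proof
      fix t assume t: "t \<in> X"
      then have "t \<le> oracle_crit T a" using X by (auto simp: s intro: cSup_upper)
      then have "perm_prob T (\<lambda>v. MIN j\<in>hyps T. pval T j v) t w \<le> \<alpha>"
        using assms False perm_prob_mono order_trans by blast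
      then show "t \<in> Y" using t by (simp add: X_def Y_def)
    qed
    then show ?thesis using max0_mono[OF _ Y] by (simp add: o wy_crit_def Y_def)
  qed
qed

text \<open>The slack \<open>2 * \<epsilon>\<close> has two halves: one absorbs the false nulls for
  all data, the other is the deviation of the true-null hit fraction that Chebyshev's inequality
  controls.\<close>

lemma prob_oracle_le_wy_crit:
  assumes a: "0 < a" "a < 1" and \<epsilon>: "0 < \<epsilon>" and r: "0 \<le> r"
    and pval_bound: "\<And>w j. w \<in> possible_data T \<Longrightarrow> j \<in> hyps T \<Longrightarrow>
      perm_prob T (pval T j) (oracle_crit T a) w \<le> r * oracle_crit T a"
    and k: "\<And>b. b \<in> K \<Longrightarrow> card (A b) \<le> k"
    and few: "real (card (false_nulls T)) * (r * oracle_crit T a) \<le> \<epsilon>"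
  shows "1 - real (card K) * (real k * (r * oracle_crit T a))\<^sup>2 / \<epsilon>\<^sup>2 \<le>
    prob {\<omega> \<in> space (smp T). oracle_crit T a \<le> wy_crit T (a + 2 * \<epsilon>) (W T \<omega>)}"
proof -
  define s where "s = oracle_crit T a"
  note [measurable] = wy_crit_measurable
  define good where "good = {\<omega> \<in> space (smp T). s \<le> wy_crit T (a + 2 * \<epsilon>) (W T \<omega>)}"
  have good_events: "good \<in> events" unfolding good_def by measurable
  have s0: "0 \<le> s" unfolding s_def using a by (rule oracle_crit_nonneg)
  show ?thesis
  proof (cases "s = 0")
    case True
    then have "s \<le> wy_crit T (a + 2 * \<epsilon>) (W T \<omega>)" for \<omega>
      unfolding s_def by (intro oracle_le_wy_crit disjI1)
    then have "good = space (smp T)"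
      by (simp add: good_def)
    then have "prob good = 1" by (simp only: prob_space)
    then show ?thesis by (simp add: good_def s_def)
  next
    case False
    let ?X = "{t \<in> pval_set T. prob {\<omega> \<in> space (smp T). \<exists>j\<in>true_nulls T. pval T j (W T \<omega>) \<le> t} \<le> a}"
    have "?X \<noteq> {}"
    \<comment> \<open>Without admissible levels the oracle value would be the default
      \<open>0\<close>, which the previous case covers. So \<open>oracle_crit_level\<close> is
      available.\<close>
    proof
      assume "?X = {}"
      then have "max0 ?X = 0" by (simp only: max0_def simp_thms if_True)
      then show False using False oracle_crit_eq[OF a] by (simp only: s_def)
    qed
    then have level: "prob {\<omega> \<in> space (smp T). \<exists>j\<in>true_nulls T. pval T j (W T \<omega>) \<le> s} \<le> a"
      unfolding s_def by (rule oracle_crit_level[OF a])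
    define H where "H J g = {\<omega> \<in> space (smp T). \<exists>j\<in>J. pval T j (act T g (W T \<omega>)) \<le> s}" for J g
    define Z where "Z \<omega> = (\<Sum>g\<in>perms T. indicator (H (true_nulls T) g) \<omega>) / real (card (perms T))" for \<omega>
    have H_events: "H J g \<in> events" if "J \<subseteq> hyps T" "g \<in> perms T" for J g
      unfolding H_def by (rule hit_events[OF that])
    have H_union: "(\<Union>b\<in>K. H (A b \<inter> true_nulls T) g) = H (true_nulls T) g" for g
      using true_nulls_blocks unfolding H_def by blast
    have H_fraction: "(\<Sum>g\<in>perms T. indicator (H J g) \<omega>) / real (card (perms T)) \<le> real (card J) * (r * s)"
      if "J \<subseteq> hyps T" "\<omega> \<in> space (smp T)" for J \<omega>
      unfolding H_def using that W_possible
      by (intro hit_fraction_le) (auto simp: s_def intro!: pval_bound)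
    have "prob {\<omega> \<in> space (smp T). a + \<epsilon> \<le>
          (\<Sum>g\<in>perms T. indicator (\<Union>b\<in>K. H (A b \<inter> true_nulls T) g) \<omega>) / real (card (perms T))}
        \<le> real (card K) * (real k * (r * s))\<^sup>2 / \<epsilon>\<^sup>2"
    \<comment> \<open>The value of \<open>c\<close> comes from the union bound within a block: at
      most \<open>k\<close> null \<open>p\<close>-values, each with permutation probability at most
      \<open>r * s\<close>.\<close>
    proof (rule prob_mean_union_deviation[where U = "\<lambda>g b. H (A b \<inter> true_nulls T) g"
          and c = "real k * (r * s)" and \<mu> = a, OF finite_perms _ finite_K K_nonempty _ _ _ _ \<epsilon>])
      show "perms T \<noteq> {}" using id_perms by blast
      show "H (A b \<inter> true_nulls T) g \<in> events" if "g \<in> perms T" for g b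
        using that true_nulls_subset by (intro H_events) auto
      show "prob (\<Inter>b\<in>K. space (smp T) - (H (A b \<inter> true_nulls T) g \<union> H (A b \<inter> true_nulls T) h)) =
          (\<Prod>b\<in>K. prob (space (smp T) - (H (A b \<inter> true_nulls T) g \<union> H (A b \<inter> true_nulls T) h)))"
        if "g \<in> perms T" "h \<in> perms T" for g h
        unfolding H_def using that by (rule block_independence)
      show "(\<Sum>g\<in>perms T. indicator (H (A b \<inter> true_nulls T) g) \<omega>) / real (card (perms T)) \<le> real k * (r * s)"
        if b: "b \<in> K" and \<omega>: "\<omega> \<in> space (smp T)" for b \<omega>
      proof -
        have "finite (A b)" using b cover finite_hyps by (metis UN_upper finite_subset)
        then have "card (A b \<inter> true_nulls T) \<le> k"
          using k[OF b] by (meson card_mono inf_le1 order_trans)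
        then have "real (card (A b \<inter> true_nulls T)) * (r * s) \<le> real k * (r * s)"
          using r s0 by (intro mult_right_mono) auto
        then show ?thesis
          by (rule order_trans[OF H_fraction[OF le_infI2[OF true_nulls_subset] \<omega>]])
      qed
      show "(\<Sum>g\<in>perms T. prob (\<Union>b\<in>K. H (A b \<inter> true_nulls T) g)) / real (card (perms T)) \<le> a"
        using mean_null_hit[of s] level unfolding H_union by (simp add: H_def)
    qed
    then have bad: "prob {\<omega> \<in> space (smp T). a + \<epsilon> \<le> Z \<omega>} \<le> real (card K) * (real k * (r * s))\<^sup>2 / \<epsilon>\<^sup>2"
      by (simp only: H_union Z_def)
    \<comment> \<open>Failure forces the permutation probability at \<open>s\<close> above
      \<open>a + 2 * \<epsilon>\<close>; false nulls supply at most \<open>\<epsilon>\<close> of it,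
      so true nulls supply the rest.\<close>
    have "space (smp T) - good \<subseteq> {\<omega> \<in> space (smp T). a + \<epsilon> \<le> Z \<omega>}"
    proof safe
      fix \<omega> assume \<omega>: "\<omega> \<in> space (smp T)" "\<omega> \<notin> good"
      have "perm_prob T (\<lambda>v. MIN j\<in>hyps T. pval T j v) s (W T \<omega>) =
          (\<Sum>g\<in>perms T. indicator (H (hyps T) g) \<omega>) / real (card (perms T))"
        using \<omega>
        by (simp add: perm_prob_def H_def MIN_le_iff[OF finite_hyps hyps_nonempty] indicator_def of_bool_def)
      also have "\<dots> \<le> (\<Sum>g\<in>perms T. indicator (H (true_nulls T) g) \<omega> + indicator (H (false_nulls T) g) \<omega>)
          / real (card (perms T))"
        by (intro divide_right_mono sum_mono) (auto simp: H_def indicator_def false_nulls_def)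
      also have "\<dots> = Z \<omega> + (\<Sum>g\<in>perms T. indicator (H (false_nulls T) g) \<omega>) / real (card (perms T))"
        by (simp add: Z_def sum.distrib add_divide_distrib)
      also have "\<dots> \<le> Z \<omega> + \<epsilon>"
        using H_fraction[of "false_nulls T" \<omega>] few \<omega> by (simp add: false_nulls_def s_def)
      finally have "perm_prob T (\<lambda>v. MIN j\<in>hyps T. pval T j v) s (W T \<omega>) \<le> Z \<omega> + \<epsilon>" .
      moreover have "\<not> perm_prob T (\<lambda>v. MIN j\<in>hyps T. pval T j v) s (W T \<omega>) \<le> a + 2 * \<epsilon>"
        using \<omega> oracle_le_wy_crit[OF disjI2, of a "W T \<omega>" "a + 2 * \<epsilon>"]
        unfolding good_def s_def by blast
      ultimately show "a + \<epsilon> \<le> Z \<omega>" by linarith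
    qed
    moreover have "{\<omega> \<in> space (smp T). a + \<epsilon> \<le> Z \<omega>} \<in> events"
    proof -
      have [measurable]: "H (true_nulls T) g \<in> events" if "g \<in> perms T" for g
        using true_nulls_subset that by (rule H_events)
      show ?thesis unfolding Z_def by measurable
    qed
    ultimately have "prob (space (smp T) - good) \<le> real (card K) * (real k * (r * s))\<^sup>2 / \<epsilon>\<^sup>2"
      using bad by (meson finite_measure_mono order_trans)
    then have "1 - real (card K) * (real k * (r * s))\<^sup>2 / \<epsilon>\<^sup>2 \<le> prob good"
      using good_events by (simp add: prob_compl)
    then show ?thesis by (simp add: good_def s_def)
  qed
qed

end

section \<open>Passage to the limit\<close>

theorem theorem1:
  fixes T :: "nat \<Rightarrow> 'a testing_problem"
    and S :: "nat \<Rightarrow> real set"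
    and A :: "nat \<Rightarrow> nat \<Rightarrow> nat set"
    and B :: "nat \<Rightarrow> nat"
    and \<alpha> \<delta> :: real
  assumes problems: "\<And>m. m \<ge> 1 \<Longrightarrow> valid_problem (T m)"
    and num_hyp: "\<And>m. m \<ge> 1 \<Longrightarrow> num_hyp (T m) = m"
    and pval_set: "\<And>m. m \<ge> 1 \<Longrightarrow> pval_set (T m) = S (num_obs (T m))"
    and A1_cover: "\<And>m. m \<ge> 1 \<Longrightarrow> (\<Union>b\<in>{1..B m}. A m b) = {1..m}"
    and A1_disjoint: "\<And>m. m \<ge> 1 \<Longrightarrow> disjoint_family_on (A m) {1..B m}"
    and A1_nulls: "\<And>m b. m \<ge> 1 \<Longrightarrow> b \<in> {1..B m} \<Longrightarrow> A m b \<inter> true_nulls (T m) \<noteq> {}"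
    and A1_indep: "\<And>m g g'. m \<ge> 1 \<Longrightarrow> g \<in> perms (T m) \<Longrightarrow> g' \<in> perms (T m) \<Longrightarrow>
      prob_space.indep_vars (smp (T m)) (\<lambda>b. borel)
        (\<lambda>b \<omega>. MIN h\<in>{g, g'}. MIN j\<in>A m b \<inter> true_nulls (T m).
           pval (T m) j (act (T m) h (W (T m) \<omega>)))
        {1..B m}"
    and A2: "(\<lambda>m. real (card (false_nulls (T m))) / real (B m)) \<longlonglongrightarrow> 0"
    and A3: "(\<lambda>m. real (MAX b\<in>{1..B m}. card (A m b))) \<in> o(\<lambda>m. sqrt (real (B m)))"
    and B1: "\<And>m. m \<ge> 1 \<Longrightarrow>
      distr (smp (T m)) (\<Pi>\<^sub>M j\<in>true_nulls (T m). borel)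
        (\<lambda>\<omega>. \<lambda>j\<in>true_nulls (T m). pval (T m) j (W (T m) \<omega>)) =
      distr (smp (T m) \<Otimes>\<^sub>M uniform_count_measure (perms (T m))) (\<Pi>\<^sub>M j\<in>true_nulls (T m). borel)
        (\<lambda>(\<omega>, G). \<lambda>j\<in>true_nulls (T m). pval (T m) j (act (T m) G (W (T m) \<omega>)))"
    and B2: "\<And>\<alpha>'. 0 < \<alpha>' \<Longrightarrow> \<alpha>' < 1 \<Longrightarrow>
      \<exists>r>0. \<forall>m\<ge>1. \<forall>w\<in>possible_data (T m). \<forall>j\<in>{1..m}.
        (let s = oracle_crit (T m) \<alpha>' in
          inverse r * s \<le> perm_prob (T m) (pval (T m) j) s w \<and>
          perm_prob (T m) (pval (T m) j) s w \<le> r * s)"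
    and B3: "\<And>m j s. m \<ge> 1 \<Longrightarrow> j \<in> true_nulls (T m) \<Longrightarrow> s \<in> pval_set (T m) \<Longrightarrow>
      measure (smp (T m)) {\<omega> \<in> space (smp (T m)). pval (T m) j (W (T m) \<omega>) \<le> s} = s"
    and \<alpha>: "0 < \<alpha>" "\<alpha> < 1"
    and \<delta>: "0 < \<delta>" "\<delta> < \<alpha>"
  shows "(\<lambda>m. measure (smp (T m)) {\<omega> \<in> space (smp (T m)).
      wy_crit (T m) \<alpha> (W (T m) \<omega>) \<ge> oracle_crit (T m) (\<alpha> - \<delta>)}) \<longlonglongrightarrow> 1"
proof -
  define a where "a = \<alpha> - \<delta>"
  \<comment> \<open>The constant of \<open>oracle_crit_bound\<close>: the oracle value is at most
    \<open>C / B m\<close>, with \<open>C\<close> independent of \<open>m\<close>.\<close>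
  define C where "C = - ln (1 - a)"
  have a: "0 < a" "a < 1" using \<alpha> \<delta> by (auto simp: a_def)
  have C: "0 \<le> C" using a by (simp add: C_def)
  define k where "k m = (MAX b\<in>{1..B m}. card (A m b))" for m
  define s where "s m = oracle_crit (T m) a" for m
  define good where "good m = measure (smp (T m)) {\<omega> \<in> space (smp (T m)).
      s m \<le> wy_crit (T m) \<alpha> (W (T m) \<omega>)}" for m
  \<comment> \<open>The level \<open>a\<close> is the same for all problems, so (B2) supplies a
    single \<open>r\<close> for the whole sequence.\<close>
  obtain r where r: "0 < r"
    and bound: "\<And>m w j. m \<ge> 1 \<Longrightarrow> w \<in> possible_data (T m) \<Longrightarrow> j \<in> {1..m} \<Longrightarrow>
      perm_prob (T m) (pval (T m) j) (s m) w \<le> r * s m"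
    using B2[OF a] unfolding Let_def s_def by blast
  have block: "block_problem (T m) (A m) {1..B m}" if "m \<ge> 1" for m
    using problems A1_cover A1_nulls A1_indep B1 B3 num_hyp that
    by unfold_locales (auto simp: hyps_def)
  have s_bounds: "0 \<le> s m" "s m * real (B m) \<le> C" "0 < B m" if "m \<ge> 1" for m
  proof -
    interpret block_problem "T m" "A m" "{1..B m}" using block[OF that] .
    show "0 \<le> s m" unfolding s_def using a by (rule oracle_crit_nonneg)
    show "s m * real (B m) \<le> C" using oracle_crit_bound[OF a] by (simp add: s_def C_def)
    show "0 < B m" using K_nonempty by simp
  qed
  have s_le: "s m \<le> C / real (B m)" if "m \<ge> 1" for m
    using s_bounds[OF that] by (simp add: pos_le_divide_eq)
  define q where "q m = real (k m) / sqrt (real (B m))" for m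
  have q: "q \<longlonglongrightarrow> 0"
    using smalloD_tendsto[OF A3] by (simp add: q_def[abs_def] k_def)
  define f where "f m = real (card (false_nulls (T m))) / real (B m)" for m
  have "(\<lambda>m. r * C * f m) \<longlonglongrightarrow> 0"
    using tendsto_mult_right_zero[OF A2] by (simp add: f_def)
  then have few: "\<forall>\<^sub>F m in sequentially. r * C * f m < \<delta> / 2"
    using \<delta> by (intro order_tendstoD(2)) auto
  \<comment> \<open>The finite bound is applied with \<open>\<epsilon> = \<delta> / 2\<close>, for
    which \<open>a + 2 * \<epsilon>\<close> is \<open>\<alpha>\<close>. By (A2) the false nulls
    eventually fit into this \<open>\<epsilon>\<close>.\<close>
  have lower: "\<forall>\<^sub>F m in sequentially. 1 - (r * C * q m)\<^sup>2 / (\<delta> / 2)\<^sup>2 \<le> good m"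
    using few eventually_ge_at_top[of 1]
  proof eventually_elim
    case (elim m)
    interpret block_problem "T m" "A m" "{1..B m}" using block elim by simp
    note B = s_bounds(3)[OF elim(2)]
    have "real (card (false_nulls (T m))) * (r * s m) \<le>
        real (card (false_nulls (T m))) * (r * (C / real (B m)))"
      using r s_le[OF elim(2)] by (intro mult_left_mono) auto
    also have "\<dots> \<le> \<delta> / 2" using elim(1) by (simp add: f_def mult_ac)
    finally have "1 - real (card {1..B m}) * (real (k m) * (r * s m))\<^sup>2 / (\<delta> / 2)\<^sup>2 \<le>
        prob {\<omega> \<in> space (smp (T m)). s m \<le> wy_crit (T m) (a + 2 * (\<delta> / 2)) (W (T m) \<omega>)}"
      unfolding s_def using a \<delta> r bound[OF elim(2)] num_hyp[OF elim(2)]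
      by (intro prob_oracle_le_wy_crit) (auto simp: hyps_def s_def k_def)
    then have "1 - real (B m) * (real (k m) * (r * s m))\<^sup>2 / (\<delta> / 2)\<^sup>2 \<le> good m"
      by (simp add: good_def a_def)
    \<comment> \<open>Inserting \<open>s m \<le> C / B m\<close> leaves
      \<open>(r * C * k m)\<^sup>2 / B m\<close>, the square of a multiple of the ratio that (A3)
      sends to zero.\<close>
    moreover have "real (B m) * (real (k m) * (r * s m))\<^sup>2 \<le> (r * C * q m)\<^sup>2"
    proof -
      have "real (B m) * (real (k m) * (r * s m))\<^sup>2 \<le> real (B m) * (real (k m) * (r * (C / real (B m))))\<^sup>2"
        using r s_le[OF elim(2)] s_bounds(1)[OF elim(2)]
        by (intro mult_left_mono power_mono) auto
      also have "\<dots> = (r * C * q m)\<^sup>2"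
        using B by (simp add: q_def power_mult_distrib power_divide power2_eq_square)
      finally show ?thesis .
    qed
    then have "real (B m) * (real (k m) * (r * s m))\<^sup>2 / (\<delta> / 2)\<^sup>2 \<le> (r * C * q m)\<^sup>2 / (\<delta> / 2)\<^sup>2"
      by (intro divide_right_mono) auto
    ultimately show ?case by linarith
  qed
  have upper: "\<forall>\<^sub>F m in sequentially. good m \<le> 1"
    using eventually_ge_at_top[of 1]
  proof eventually_elim
    case (elim m)
    interpret block_problem "T m" "A m" "{1..B m}" using block elim by simp
    show ?case by (simp add: good_def)
  qed
  have "(\<lambda>m. 1 - (r * C * q m)\<^sup>2 / (\<delta> / 2)\<^sup>2) \<longlonglongrightarrow> 1 - (r * C * 0)\<^sup>2 / (\<delta> / 2)\<^sup>2"
    using \<delta> by (intro tendsto_intros q) auto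
  then have "(\<lambda>m. 1 - (r * C * q m)\<^sup>2 / (\<delta> / 2)\<^sup>2) \<longlonglongrightarrow> 1" by simp
  then have "good \<longlonglongrightarrow> 1"
    using lower upper by (rule tendsto_sandwich[rotated 2, OF _ tendsto_const])
  then show ?thesis by (simp add: good_def[abs_def] s_def a_def)
qed

end
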